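(* Let $s\in\{0,\tfrac12\}$. Every irreducible Harish-Chandra module over the Schr\"odinger-Virasoro algebra $\mathcal{L}[s]$ is a highest weight module, a lowest weight module, or a uniformly bounded module. *)

theory Defs
  imports Complex_Main
begin

text \<open>
  The Schroedinger-Virasoro algebra L[s] (s = 0 or 1/2) over the complex numbers has basis
  L_n, M_n (n integer) and Y_p (p in s + Z), with brackets
    [L_m, L_n] = (n - m) L_(m+n),   [L_m, M_n] = n M_(m+n),
    [L_m, Y_p] = (p - m/2) Y_(m+p), [Y_p, Y_q] = (q - p) M_(p+q),
    [M_m, M_n] = [M_m, Y_p] = 0.
  A module over L[s] on an abstract complex vector space (carrier = the type 'v, scalar
  multiplication smul) is given by linear operators Lop n, Mop n, Yop k, where Yop k is the
  action of Y_(k+s), satisfying the commutation relations.  Note that for p = k+s, q = l+s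
  one has p + q = k + l + 2s, and 2s = floor (2s) since s is 0 or 1/2.
\<close>

definition sv_module ::
  "real \<Rightarrow> (complex \<Rightarrow> 'v::ab_group_add \<Rightarrow> 'v) \<Rightarrow> (int \<Rightarrow> 'v \<Rightarrow> 'v)
    \<Rightarrow> (int \<Rightarrow> 'v \<Rightarrow> 'v) \<Rightarrow> (int \<Rightarrow> 'v \<Rightarrow> 'v) \<Rightarrow> bool" where
  "sv_module s smul Lop Mop Yop \<longleftrightarrow>
     vector_space smul \<and>
     (\<forall>n. Vector_Spaces.linear smul smul (Lop n)) \<and>
     (\<forall>n. Vector_Spaces.linear smul smul (Mop n)) \<and>
     (\<forall>k. Vector_Spaces.linear smul smul (Yop k)) \<and>
     (\<forall>m n v. Lop m (Lop n v) - Lop n (Lop m v) = smul (of_int (n - m)) (Lop (m + n) v)) \<and>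
     (\<forall>m n v. Lop m (Mop n v) - Mop n (Lop m v) = smul (of_int n) (Mop (m + n) v)) \<and>
     (\<forall>m k v. Lop m (Yop k v) - Yop k (Lop m v)
                = smul (complex_of_real (real_of_int k + s - real_of_int m / 2)) (Yop (m + k) v)) \<and>
     (\<forall>k l v. Yop k (Yop l v) - Yop l (Yop k v)
                = smul (of_int (l - k)) (Mop (k + l + \<lfloor>2 * s\<rfloor>) v)) \<and>
     (\<forall>m n v. Mop m (Mop n v) = Mop n (Mop m v)) \<and>
     (\<forall>m k v. Mop m (Yop k v) = Yop k (Mop m v))"

definition sv_submodule ::
  "(complex \<Rightarrow> 'v::ab_group_add \<Rightarrow> 'v) \<Rightarrow> (int \<Rightarrow> 'v \<Rightarrow> 'v)
    \<Rightarrow> (int \<Rightarrow> 'v \<Rightarrow> 'v) \<Rightarrow> (int \<Rightarrow> 'v \<Rightarrow> 'v) \<Rightarrow> 'v set \<Rightarrow> bool" where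
  "sv_submodule smul Lop Mop Yop W \<longleftrightarrow>
     module.subspace smul W \<and>
     (\<forall>n. \<forall>w\<in>W. Lop n w \<in> W \<and> Mop n w \<in> W \<and> Yop n w \<in> W)"

definition sv_irreducible ::
  "(complex \<Rightarrow> 'v::ab_group_add \<Rightarrow> 'v) \<Rightarrow> (int \<Rightarrow> 'v \<Rightarrow> 'v)
    \<Rightarrow> (int \<Rightarrow> 'v \<Rightarrow> 'v) \<Rightarrow> (int \<Rightarrow> 'v \<Rightarrow> 'v) \<Rightarrow> bool" where
  "sv_irreducible smul Lop Mop Yop \<longleftrightarrow>
     (UNIV :: 'v set) \<noteq> {0} \<and>
     (\<forall>W. sv_submodule smul Lop Mop Yop W \<longrightarrow> W = {0} \<or> W = UNIV)"

definition weight_space ::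
  "(complex \<Rightarrow> 'v::ab_group_add \<Rightarrow> 'v) \<Rightarrow> (int \<Rightarrow> 'v \<Rightarrow> 'v) \<Rightarrow> complex \<Rightarrow> 'v set" where
  "weight_space smul Lop \<mu> = {v. Lop 0 v = smul \<mu> v}"

definition weight_module ::
  "(complex \<Rightarrow> 'v::ab_group_add \<Rightarrow> 'v) \<Rightarrow> (int \<Rightarrow> 'v \<Rightarrow> 'v) \<Rightarrow> bool" where
  "weight_module smul Lop \<longleftrightarrow>
     module.span smul (\<Union>\<mu>. weight_space smul Lop \<mu>) = UNIV"

definition harish_chandra_module ::
  "(complex \<Rightarrow> 'v::ab_group_add \<Rightarrow> 'v) \<Rightarrow> (int \<Rightarrow> 'v \<Rightarrow> 'v) \<Rightarrow> bool" where
  "harish_chandra_module smul Lop \<longleftrightarrow>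
     weight_module smul Lop \<and>
     (\<forall>\<mu>. \<exists>B. finite B \<and> B \<subseteq> weight_space smul Lop \<mu> \<and>
              module.span smul B = weight_space smul Lop \<mu>)"

definition uniformly_bounded ::
  "(complex \<Rightarrow> 'v::ab_group_add \<Rightarrow> 'v) \<Rightarrow> (int \<Rightarrow> 'v \<Rightarrow> 'v) \<Rightarrow> bool" where
  "uniformly_bounded smul Lop \<longleftrightarrow>
     (\<exists>N::nat. \<forall>\<mu>. vector_space.dim smul (weight_space smul Lop \<mu>) \<le> N)"

definition generated_by ::
  "(complex \<Rightarrow> 'v::ab_group_add \<Rightarrow> 'v) \<Rightarrow> (int \<Rightarrow> 'v \<Rightarrow> 'v)
    \<Rightarrow> (int \<Rightarrow> 'v \<Rightarrow> 'v) \<Rightarrow> (int \<Rightarrow> 'v \<Rightarrow> 'v) \<Rightarrow> 'v \<Rightarrow> bool" where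
  "generated_by smul Lop Mop Yop v \<longleftrightarrow>
     (\<forall>W. sv_submodule smul Lop Mop Yop W \<and> v \<in> W \<longrightarrow> W = UNIV)"

definition highest_weight_module ::
  "real \<Rightarrow> (complex \<Rightarrow> 'v::ab_group_add \<Rightarrow> 'v) \<Rightarrow> (int \<Rightarrow> 'v \<Rightarrow> 'v)
    \<Rightarrow> (int \<Rightarrow> 'v \<Rightarrow> 'v) \<Rightarrow> (int \<Rightarrow> 'v \<Rightarrow> 'v) \<Rightarrow> bool" where
  "highest_weight_module s smul Lop Mop Yop \<longleftrightarrow>
     (\<exists>v \<mu>. v \<noteq> 0 \<and> v \<in> weight_space smul Lop \<mu> \<and>
        (\<forall>n>0. Lop n v = 0 \<and> Mop n v = 0) \<and>
        (\<forall>k. real_of_int k + s > 0 \<longrightarrow> Yop k v = 0) \<and>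
        generated_by smul Lop Mop Yop v)"

definition lowest_weight_module ::
  "real \<Rightarrow> (complex \<Rightarrow> 'v::ab_group_add \<Rightarrow> 'v) \<Rightarrow> (int \<Rightarrow> 'v \<Rightarrow> 'v)
    \<Rightarrow> (int \<Rightarrow> 'v \<Rightarrow> 'v) \<Rightarrow> (int \<Rightarrow> 'v \<Rightarrow> 'v) \<Rightarrow> bool" where
  "lowest_weight_module s smul Lop Mop Yop \<longleftrightarrow>
     (\<exists>v \<mu>. v \<noteq> 0 \<and> v \<in> weight_space smul Lop \<mu> \<and>
        (\<forall>n<0. Lop n v = 0 \<and> Mop n v = 0) \<and>
        (\<forall>k. real_of_int k + s < 0 \<longrightarrow> Yop k v = 0) \<and>
        generated_by smul Lop Mop Yop v)"

end

theory Submission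
  imports Defs
begin

text \<open>
  If the weight multiplicities are unbounded in the negative direction, then far below a fixed
  window of four weight spaces there is a nonzero weight vector killed by \<open>L\<^sub>k\<close>, \<open>L\<^sub>k\<^sub>+\<^sub>1\<close>, \<open>M\<^sub>k\<close>
  and \<open>Y\<^sub>k\<^sub>+\<^sub>s\<close> for some \<open>k \<ge> 1\<close>, hence by all operators of large degree. The vectors with this last
  property form a submodule, so every vector is of this kind, and finitely many weight spaces in
  a window are killed by all operators of degree at least some common \<open>x\<close>. The submodule generated by
  everything below the top of the window is built above it with raising operators only, so \<open>x\<close>
  works for all its higher vectors as well. If it vanishes in large degrees, a vector of maximal degree is
  a highest weight vector; otherwise a vector \<open>u\<close> of large degree is one, because
  \<open>L\<^sub>-\<^sub>J u\<close> is still killed by the operators of degree at least \<open>x\<close>, and commuting these with \<open>L\<^sub>-\<^sub>J\<close>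
  gives all operators of positive degree. Unboundedness in the positive direction is reduced to this case
  by the automorphism \<open>L\<^sub>n \<mapsto> - L\<^sub>-\<^sub>n\<close>, \<open>M\<^sub>n \<mapsto> - M\<^sub>-\<^sub>n\<close>, \<open>Y\<^sub>p \<mapsto> Y\<^sub>-\<^sub>p\<close>.
\<close>

section \<open>Dimension estimates in finite-dimensional spaces\<close>

context vector_space
begin

text \<open>Rank-nullity: a basis of the kernel together with preimages of a basis of the image
  spans \<open>U\<close>. The finite set \<open>B\<close> keeps both bases finite, so that
  \<open>card\<close> measures them.\<close>

lemma dim_kernel_image:
  assumes lin: "Vector_Spaces.linear scale scale f"
    and U: "subspace U" and fin: "finite B" "U \<subseteq> span B"
  shows "dim U \<le> dim {u \<in> U. f u = 0} + dim (f ` U)"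
proof -
  interpret f: Vector_Spaces.linear scale scale f by (rule lin)
  obtain K where K: "K \<subseteq> {u \<in> U. f u = 0}" "independent K" "{u \<in> U. f u = 0} \<subseteq> span K"
    "card K = dim {u \<in> U. f u = 0}"
    by (rule basis_exists)
  obtain C where C: "C \<subseteq> f ` U" "independent C" "f ` U \<subseteq> span C" "card C = dim (f ` U)"
    by (rule basis_exists)
  have "K \<subseteq> span B" using K(1) fin by blast
  then have finK: "finite K" using independent_span_bound[OF fin(1) K(2)] by blast
  have "f ` U \<subseteq> span (f ` B)"
    using fin(2) f.span_image[of B] by blast
  then have finC: "finite C"
    using independent_span_bound[of "f ` B" C] C fin(1) by blast
  obtain D where D: "D \<subseteq> U" "C = f ` D" "inj_on f D"
    using C(1) by (meson subset_image_inj)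
  have finD: "finite D" using finC D finite_imageD by blast
  have cardD: "card D = card C" using D card_image by metis
  have "U \<subseteq> span (K \<union> D)"
  proof
    fix u assume u: "u \<in> U"
    then have "f u \<in> f ` span D" using C(3) D(2) f.span_image[of D] by blast
    then obtain d where d: "d \<in> span D" "f u = f d" by blast
    have "d \<in> U" using d(1) D(1) U span_minimal by blast
    then have "u - d \<in> {u \<in> U. f u = 0}"
      using u U d(2) by (simp add: subspace_diff f.diff)
    then have "u - d \<in> span (K \<union> D)"
      using K(3) span_mono[of K "K \<union> D"] by blast
    moreover have "d \<in> span (K \<union> D)" using d(1) span_mono[of D "K \<union> D"] by blast
    ultimately show "u \<in> span (K \<union> D)" using span_add by fastforce
  qed
  then have "dim U \<le> card (K \<union> D)" using dim_le_card finK finD by blast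
  also have "\<dots> \<le> card K + card D" by (rule card_Un_le)
  finally show ?thesis using K(4) C(4) cardD by simp
qed

text \<open>\<open>dim\<close> is 0 on an infinite-dimensional set, so monotonicity relies on a
  finite bound \<open>B\<close> for the larger set \<open>C\<close>.\<close>

lemma dim_mono_finite:
  assumes "A \<subseteq> span C" "finite B" "C \<subseteq> span B"
  shows "dim A \<le> dim C"
proof -
  obtain D where D: "D \<subseteq> C" "independent D" "C \<subseteq> span D" "card D = dim C"
    by (rule basis_exists)
  have "finite D" using independent_span_bound[OF assms(2) D(2)] D(1) assms(3) by blast
  moreover have "A \<subseteq> span D" using assms(1) D(3) span_minimal subspace_span by blast
  ultimately show ?thesis using dim_le_card D(4) by metis
qed

end

section \<open>Generators graded by degree and their brackets\<close>

locale sv_rep = vector_space smul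
  for smul :: "complex \<Rightarrow> 'v::ab_group_add \<Rightarrow> 'v" +
  fixes s :: real and Lop Mop Yop :: "int \<Rightarrow> 'v \<Rightarrow> 'v"
  assumes s_cases: "s \<in> {0, 1/2}"
    and sv: "sv_module s smul Lop Mop Yop"
begin

abbreviation \<sigma> :: int where "\<sigma> \<equiv> \<lfloor>2 * s\<rfloor>"

lemma \<sigma>_cases: "\<sigma> = 0 \<or> \<sigma> = 1"
  and s_eq: "s = real_of_int \<sigma> / 2"
proof -
  have "2 * s = 0 \<or> 2 * s = 1" using s_cases by auto
  then have "(\<sigma> = 0 \<or> \<sigma> = 1) \<and> 2 * s = real_of_int \<sigma>"
    by (elim disjE) (simp_all only: floor_zero floor_one of_int_0 of_int_1 simp_thms)
  then show "\<sigma> = 0 \<or> \<sigma> = 1" "s = real_of_int \<sigma> / 2" by (blast, linarith)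
qed

text \<open>Degrees are doubled so that they are integers also for \<open>s = 1/2\<close>.\<close>

inductive graded_op :: "int \<Rightarrow> ('v \<Rightarrow> 'v) \<Rightarrow> bool" where
  L: "graded_op (2 * n) (Lop n)"
| M: "graded_op (2 * n) (Mop n)"
| Y: "graded_op (2 * k + \<sigma>) (Yop k)"

lemma bracket_LL: "Lop m (Lop n v) - Lop n (Lop m v) = smul (of_int (n - m)) (Lop (m + n) v)"
  and bracket_LM: "Lop m (Mop n v) - Mop n (Lop m v) = smul (of_int n) (Mop (m + n) v)"
  and bracket_LY: "Lop m (Yop k v) - Yop k (Lop m v) =
    smul (complex_of_real (real_of_int k + s - real_of_int m / 2)) (Yop (m + k) v)"
  and bracket_YY: "Yop k (Yop l v) - Yop l (Yop k v) = smul (of_int (l - k)) (Mop (k + l + \<sigma>) v)"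
  and bracket_MM: "Mop m (Mop n v) = Mop n (Mop m v)"
  and bracket_MY: "Mop m (Yop k v) = Yop k (Mop m v)"
  using sv unfolding sv_module_def by blast+

lemma linear_op: "graded_op i X \<Longrightarrow> Vector_Spaces.linear smul smul X"
  using sv unfolding sv_module_def by (auto elim: graded_op.cases)

lemma op_add: "graded_op i X \<Longrightarrow> X (u + v) = X u + X v"
  and op_diff: "graded_op i X \<Longrightarrow> X (u - v) = X u - X v"
  and op_scale: "graded_op i X \<Longrightarrow> X (smul c v) = smul c (X v)"
  and op_zero: "graded_op i X \<Longrightarrow> X 0 = 0"
proof -
  assume "graded_op i X"
  then interpret X: Vector_Spaces.linear smul smul X by (rule linear_op)
  show "X (u + v) = X u + X v" "X (u - v) = X u - X v" "X (smul c v) = smul c (X v)" "X 0 = 0"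
    by (simp_all add: X.add X.diff X.scale X.zero)
qed

text \<open>One uniform form of all brackets, so that later inductions need no case split on
  generators. For commuting pairs \<open>c\<close> is 0 and \<open>R\<close> is some generator of
  degree \<open>i + j\<close>.\<close>

lemma graded_bracket:
  assumes "graded_op i X" "graded_op j Z"
  shows "\<exists>c R. graded_op (i + j) R \<and> (\<forall>v. X (Z v) = Z (X v) + smul c (R v))"
proof -
  have *: "\<exists>c R. graded_op d R \<and> (\<forall>v. A (B v) = B (A v) + smul c (R v))"
    if "\<And>v. A (B v) - B (A v) = smul c (R v)" "graded_op d R" for A B R :: "'v \<Rightarrow> 'v" and c d
    using that by (metis add.commute diff_add_cancel)
  have neg: "\<exists>c R. graded_op d R \<and> (\<forall>v. A (B v) = B (A v) + smul c (R v))"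
    if "\<And>v. B (A v) - A (B v) = smul c (R v)" "graded_op d R" for A B R :: "'v \<Rightarrow> 'v" and c d
  proof (rule *[of _ _ "- c"])
    show "A (B v) - B (A v) = smul (- c) (R v)" for v
      using that(1)[of v] by (metis minus_diff_eq scale_minus_left)
  qed (rule that(2))
  have LL: "graded_op (2 * m + 2 * n) (Lop (m + n))" for m n
    using graded_op.L[of "m + n"] by (simp add: algebra_simps)
  have MM: "graded_op (2 * m + 2 * n) (Mop (m + n))" for m n
    using graded_op.M[of "m + n"] by (simp add: algebra_simps)
  have YY: "graded_op (2 * m + (2 * n + \<sigma>)) (Yop (m + n))" for m n
    using graded_op.Y[of "m + n"] by (simp add: algebra_simps)
  have YM: "graded_op (2 * m + \<sigma> + (2 * n + \<sigma>)) (Mop (m + n + \<sigma>))" for m n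
    using graded_op.M[of "m + n + \<sigma>"] by (simp add: algebra_simps)
  show ?thesis
    using assms(1)
  proof cases
    case X: (L m)
    from assms(2) show ?thesis
    proof cases
      case (L n) then show ?thesis using *[of "Lop m" "Lop n", OF bracket_LL LL] X by simp
    next
      case (M n) then show ?thesis using *[of "Lop m" "Mop n", OF bracket_LM MM] X by simp
    next
      case (Y n) then show ?thesis using *[of "Lop m" "Yop n", OF bracket_LY YY] X by simp
    qed
  next
    case X: (M m)
    from assms(2) show ?thesis
    proof cases
      case (L n) then show ?thesis
        using neg[of "Lop n" "Mop m", OF bracket_LM MM] X by (simp add: add.commute)
    next
      case (M n) then show ?thesis
        using *[of "Mop m" "Mop n" 0, OF _ MM] X by (simp add: bracket_MM)
    next
      case (Y n) then show ?thesis
        using *[of "Mop m" "Yop n" 0, OF _ YY] X by (simp add: bracket_MY)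
    qed
  next
    case X: (Y m)
    from assms(2) show ?thesis
    proof cases
      case (L n) then show ?thesis
        using neg[of "Lop n" "Yop m", OF bracket_LY YY] X by (simp add: add.commute)
    next
      case (M n) then show ?thesis
        using *[of "Yop m" "Mop n" 0, OF _ YY] X by (simp add: bracket_MY add.commute)
    next
      case (Y n) then show ?thesis using *[of "Yop m" "Yop n", OF bracket_YY YM] X by simp
    qed
  qed
qed

text \<open>
  Bracketing with \<open>L\<^sub>1\<close> or \<open>L\<^sub>-\<^sub>1\<close> reaches the next degree unless the structure constant vanishes, which
  happens only within degrees \<open>-4, \<dots>, 4\<close>.
\<close>

lemma bracket_invariant_all:
  assumes bracket: "\<And>i j X Z R c. P i X \<Longrightarrow> P j Z \<Longrightarrow> graded_op i X \<Longrightarrow> graded_op j Z \<Longrightarrow>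
      graded_op (i + j) R \<Longrightarrow>
      (\<And>v. X (Z v) - Z (X v) = smul c (R v)) \<Longrightarrow> c \<noteq> 0 \<Longrightarrow> P (i + j) R"
    and small: "\<And>i X. graded_op i X \<Longrightarrow> \<bar>i\<bar> \<le> 4 \<Longrightarrow> P i X"
    and op: "graded_op i X"
  shows "P i X"
proof -
  have L_step: "P (2 * (m + n)) (Lop (m + n))" if "P (2 * m) (Lop m)" "P (2 * n) (Lop n)" "n \<noteq> m" for m n
    using bracket[OF that(1,2) graded_op.L graded_op.L, of "Lop (m + n)" "of_int (n - m)"]
      bracket_LL graded_op.L[of "m + n"] that(3) by (simp add: algebra_simps)
  have M_step: "P (2 * (m + n)) (Mop (m + n))" if "P (2 * m) (Lop m)" "P (2 * n) (Mop n)" "n \<noteq> 0" for m n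
    using bracket[OF that(1,2) graded_op.L graded_op.M, of "Mop (m + n)" "of_int n"]
      bracket_LM graded_op.M[of "m + n"] that(3) by (simp add: algebra_simps)
  have Y_step: "P (2 * (m + n) + \<sigma>) (Yop (m + n))"
    if "P (2 * m) (Lop m)" "P (2 * n + \<sigma>) (Yop n)" "2 * n + \<sigma> \<noteq> m" for m n
  proof -
    \<comment> \<open>By \<open>s_eq\<close> the structure constant is half the integer
      \<open>2 * n + \<sigma> - m\<close>, which the third premise keeps away from 0.\<close>
    have "real_of_int n + s - real_of_int m / 2 = real_of_int (2 * n + \<sigma> - m) / 2"
      by (subst s_eq) (simp add: field_simps)
    then have "complex_of_real (real_of_int n + s - real_of_int m / 2) \<noteq> 0"
      using that(3) by (metis divide_eq_0_iff eq_iff_diff_eq_0 of_int_eq_0_iff of_real_eq_0_iff zero_neq_numeral)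
    then show ?thesis
      using bracket[OF that(1,2) graded_op.L graded_op.Y _ bracket_LY]
        graded_op.Y[of "m + n"] by (simp add: algebra_simps)
  qed
  have L_small: "P (2 * n) (Lop n)" and M_small: "P (2 * n) (Mop n)" if "\<bar>n\<bar> \<le> 2" for n
    using small[OF graded_op.L[of n]] small[OF graded_op.M[of n]] that by auto
  \<comment> \<open>The degrees are \<open>2 * n + \<sigma>\<close> with \<open>\<sigma>\<close> 0
    or 1, hence between -4 and 3.\<close>
  have Y_small: "P (2 * n + \<sigma>) (Yop n)" if "-2 \<le> n" "n \<le> 1" for n
    using small[OF graded_op.Y[of n]] that \<sigma>_cases by auto
  have Lp: "P (2 * n) (Lop n)" if "2 \<le> n" for n
    using that by (induction n rule: int_ge_induct)
      (use L_small[of 1] L_small[of 2] L_step[of 1] in \<open>auto simp: add.commute\<close>)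
  have Lm: "P (2 * n) (Lop n)" if "n \<le> -2" for n
    using that by (induction n rule: int_le_induct)
      (use L_small[of "-1"] L_small[of "-2"] L_step[of "-1"] in auto)
  have Mp: "P (2 * n) (Mop n)" if "2 \<le> n" for n
    using that by (induction n rule: int_ge_induct)
      (use L_small[of 1] M_small[of 2] M_step[of 1] in \<open>auto simp: add.commute\<close>)
  have Mm: "P (2 * n) (Mop n)" if "n \<le> -2" for n
    using that by (induction n rule: int_le_induct)
      (use L_small[of "-1"] M_small[of "-2"] M_step[of "-1"] in auto)
  \<comment> \<open>Here \<open>2 * n + \<sigma>\<close> is at least 2, so it never takes the
    excluded value 1; in the downward case it is at most -3 and never -1.\<close>
  have Yp: "P (2 * n + \<sigma>) (Yop n)" if "1 \<le> n" for n
    using that by (induction n rule: int_ge_induct)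
      (use L_small[of 1] Y_small[of 1] Y_step[of 1] \<sigma>_cases in \<open>auto simp: add.commute\<close>)
  have Ym: "P (2 * n + \<sigma>) (Yop n)" if "n \<le> -2" for n
    using that by (induction n rule: int_le_induct)
      (use L_small[of "-1"] Y_small[of "-2"] Y_step[of "-1"] \<sigma>_cases in auto)
  show ?thesis
    using op
  proof cases
    case (L n)
    moreover have "2 \<le> n \<or> n \<le> -2 \<or> \<bar>n\<bar> \<le> 2" by linarith
    ultimately show ?thesis using Lp Lm L_small by blast
  next
    case (M n)
    moreover have "2 \<le> n \<or> n \<le> -2 \<or> \<bar>n\<bar> \<le> 2" by linarith
    ultimately show ?thesis using Mp Mm M_small by blast
  next
    case (Y n)
    moreover have "1 \<le> n \<or> n \<le> -2 \<or> -2 \<le> n \<and> n \<le> 1" by linarith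
    ultimately show ?thesis using Yp Ym Y_small by blast
  qed
qed

lemma submoduleI:
  assumes "subspace W" "\<And>i X w. graded_op i X \<Longrightarrow> w \<in> W \<Longrightarrow> X w \<in> W"
  shows "sv_submodule smul Lop Mop Yop W"
  unfolding sv_submodule_def using assms graded_op.intros by blast

section \<open>Weight spaces\<close>

abbreviation wt :: "complex \<Rightarrow> 'v set" where "wt \<equiv> weight_space smul Lop"

lemma subspace_wt: "subspace (wt \<mu>)"
  by (rule subspaceI)
    (auto simp: weight_space_def op_zero[OF graded_op.L] op_add[OF graded_op.L] op_scale[OF graded_op.L]
      scale_right_distrib scale_left_commute)

lemma op_wt:
  assumes "graded_op i X" "v \<in> wt \<mu>"
  shows "X v \<in> wt (\<mu> + of_int i / 2)"
proof -
  have "Lop 0 (X v) - X (Lop 0 v) = smul (of_int i / 2) (X v)"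
    using assms(1)
  proof cases
    case (Y k)
    have "complex_of_real (real_of_int k + s - real_of_int 0 / 2) = of_int i / 2"
      by (subst s_eq) (simp add: Y field_simps)
    then show ?thesis using bracket_LY[of 0 k v] Y by simp
  qed (use bracket_LL[of 0] bracket_LM[of 0] in simp_all)
  moreover have "X (Lop 0 v) = smul \<mu> (X v)"
    using assms by (simp add: weight_space_def op_scale)
  ultimately show ?thesis
    by (simp add: weight_space_def scale_left_distrib algebra_simps)
qed

lemma wt_sum_eq_0:
  assumes "finite F" "\<And>\<nu>. f \<nu> \<in> wt \<nu>" "(\<Sum>\<nu>\<in>F. f \<nu>) = 0" "\<mu> \<in> F"
  shows "f \<mu> = 0"
  using assms
proof (induction F arbitrary: f \<mu> rule: finite_induct)
  case (insert a F)
  interpret L0: Vector_Spaces.linear smul smul "Lop 0" by (rule linear_op[OF graded_op.L])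
  have L0: "Lop 0 (f \<nu>) = smul \<nu> (f \<nu>)" for \<nu>
    using insert.prems(1)[of \<nu>] by (simp add: weight_space_def)
  \<comment> \<open>Applying \<open>Lop 0\<close> minus \<open>a\<close> removes the
    \<open>a\<close>-component and multiplies the others by nonzero scalars, which leaves a shorter
    relation.\<close>
  have "0 = Lop 0 (\<Sum>\<nu>\<in>insert a F. f \<nu>) - smul a (\<Sum>\<nu>\<in>insert a F. f \<nu>)"
    using insert.prems(2) by (simp add: L0.zero)
  also have "\<dots> = (\<Sum>\<nu>\<in>insert a F. smul (\<nu> - a) (f \<nu>))"
    by (simp add: L0.sum L0 scale_sum_right scale_left_diff_distrib sum_subtractf)
  also have "\<dots> = (\<Sum>\<nu>\<in>F. smul (\<nu> - a) (f \<nu>))"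
    using insert.hyps by simp
  finally have sum0: "(\<Sum>\<nu>\<in>F. smul (\<nu> - a) (f \<nu>)) = 0" by simp
  have F: "f \<nu> = 0" if "\<nu> \<in> F" for \<nu>
  proof -
    have "smul (\<nu> - a) (f \<nu>) = 0"
      using insert.IH[of "\<lambda>\<nu>. smul (\<nu> - a) (f \<nu>)"] sum0 that insert.prems(1)
        subspace_scale[OF subspace_wt] by blast
    then show ?thesis using that insert.hyps by auto
  qed
  then have "f a = 0" using insert.prems(2) insert.hyps by simp
  then show ?case using F insert.prems(3) by blast
qed simp

lemma wt_disjoint_span:
  assumes "v \<in> span (\<Union>\<nu>\<in>A. wt \<nu>)" "v \<in> wt \<mu>" "\<mu> \<notin> A"
  shows "v = 0"
proof -
  have "\<exists>F f. finite F \<and> F \<subseteq> A \<and> (\<forall>\<nu>. f \<nu> \<in> wt \<nu>) \<and> v = (\<Sum>\<nu>\<in>F. f \<nu>)"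
    using assms(1)
  proof (induction rule: span_induct_alt)
    case base
    show ?case
      by (rule exI[of _ "{}"], rule exI[of _ "\<lambda>_. 0"]) (use subspace_0[OF subspace_wt] in auto)
  next
    case (step c x y)
    then obtain \<nu> F f where 1: "\<nu> \<in> A" "x \<in> wt \<nu>"
      and F: "finite F" "F \<subseteq> A" "\<And>\<nu>. f \<nu> \<in> wt \<nu>" "y = (\<Sum>\<nu>\<in>F. f \<nu>)" by blast
    \<comment> \<open>\<open>x\<close> is merged into the component of \<open>y\<close> of the same
      weight. Values of \<open>f\<close> outside \<open>F\<close> do not contribute to
      \<open>y\<close>, hence the conditional.\<close>
    define g where "g = f(\<nu> := smul c x + (if \<nu> \<in> F then f \<nu> else 0))"
    have "g \<kappa> \<in> wt \<kappa>" for \<kappa>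
      using F(3) 1(2) subspace_wt[of \<nu>] by (auto simp: g_def subspace_add subspace_scale)
    moreover have "(\<Sum>\<nu>\<in>F - {\<nu>}. g \<nu>) = (\<Sum>\<nu>\<in>F - {\<nu>}. f \<nu>)"
      by (rule sum.cong) (auto simp: g_def)
    then have "(\<Sum>\<nu>\<in>insert \<nu> F. g \<nu>) = smul c x + y"
      using F(1) by (simp add: sum.insert_remove F(4) sum.remove[of F \<nu> f] g_def add.assoc)
    ultimately show ?case
      using F 1 by (intro exI[of _ "insert \<nu> F"] exI[of _ g]) auto
  qed
  then obtain F f where F: "finite F" "F \<subseteq> A" "\<And>\<nu>. f \<nu> \<in> wt \<nu>" "v = (\<Sum>\<nu>\<in>F. f \<nu>)" by blast
  \<comment> \<open>With \<open>- v\<close> as component at \<open>\<mu>\<close> the sum becomes a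
    zero relation between distinct weights.\<close>
  define g where "g = f(\<mu> := - v)"
  have \<mu>: "\<mu> \<notin> F" using assms(3) F(2) by blast
  have "(\<Sum>\<nu>\<in>F. g \<nu>) = (\<Sum>\<nu>\<in>F. f \<nu>)"
    by (rule sum.cong) (use \<mu> in \<open>auto simp: g_def\<close>)
  then have "(\<Sum>\<nu>\<in>insert \<mu> F. g \<nu>) = 0"
    using F(1,4) \<mu> by (simp add: g_def)
  moreover have "g \<nu> \<in> wt \<nu>" for \<nu>
    using F(3) assms(2) by (simp add: g_def subspace_neg[OF subspace_wt])
  ultimately have "g \<mu> = 0" using wt_sum_eq_0[of "insert \<mu> F" g \<mu>] F(1) by blast
  then show ?thesis by (simp add: g_def)
qed

section \<open>Vanishing in all large degrees\<close>

lemma L_vanish: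
  assumes "Lop k v = 0" "Lop (k + 1) v = 0" "k \<ge> 1" "p \<ge> (k + 1) * k + 1"
  shows "Lop p v = 0"
proof -
  have step: "Lop (m + n) v = 0" if "Lop m v = 0" "Lop n v = 0" "m \<noteq> n" for m n
  proof -
    have "smul (of_int (n - m)) (Lop (m + n) v) = 0"
      using bracket_LL[of m n v] that op_zero[OF graded_op.L] by simp
    then show ?thesis using that(3) by simp
  qed
  \<comment> \<open>By \<open>step\<close>, adding \<open>k\<close> shifts a run of consecutive
    killing indices by \<open>k\<close>, and adding \<open>k + 1\<close> to its last member
    lengthens the shifted run by one.\<close>
  have run: "Lop ((int r + 2) * k + 1 + int t) v = 0" if "t \<le> r" for r t
    using that
  proof (induction r arbitrary: t)
    case 0
    then show ?case using step[OF assms(1,2)] by (simp add: algebra_simps)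
  next
    case (Suc r)
    have big: "(int r + 2) * k + 1 + int t' > k + 1" for t'
    proof -
      have "int r * k \<ge> 0" using assms(3) by simp
      moreover have "(int r + 2) * k = int r * k + 2 * k" by (rule distrib_right)
      ultimately show ?thesis using assms(3) by linarith
    qed
    show ?case
    proof (cases "t \<le> r")
      case True
      from step[OF Suc.IH[OF True] assms(1)] big[of t] show ?thesis
        by (simp add: algebra_simps)
    next
      case False
      then have t: "t = Suc r" using Suc.prems by simp
      from step[OF Suc.IH[of r] assms(2)] big[of r] show ?thesis
        by (simp add: t algebra_simps)
    qed
  qed
  \<comment> \<open>Every large \<open>p\<close> lies in such a run: its offset \<open>t\<close> is
    below \<open>k\<close>, and \<open>q \<ge> k + 1\<close> makes the run for
    \<open>r = q - 2\<close> long enough.\<close>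
  define q where "q = (p - 1) div k"
  define t where "t = (p - 1) mod k"
  have p: "p = q * k + 1 + t" unfolding q_def t_def by (simp add: algebra_simps)
  have t: "0 \<le> t" "t < k" using assms(3) by (auto simp: t_def)
  have "(k + 1) * k div k \<le> (p - 1) div k"
    by (rule zdiv_mono1) (use assms(3,4) in auto)
  then have q: "q \<ge> k + 1" using assms(3) by (simp add: q_def)
  have "Lop ((int (nat (q - 2)) + 2) * k + 1 + int (nat t)) v = 0"
    by (rule run) (use t q in auto)
  then show ?thesis using t q assms(3) by (simp add: p)
qed

text \<open>Once all large \<open>Lop p\<close> kill \<open>v\<close>, their brackets with
  \<open>Mop k\<close> and \<open>Yop k\<close> give nonzero multiples of \<open>Mop (p + k)\<close>
  and \<open>Yop (p + k)\<close>.\<close>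

lemma high_degree_vanish:
  assumes "Lop k v = 0" "Lop (k + 1) v = 0" "Mop k v = 0" "Yop k v = 0" "k \<ge> 1"
  shows "\<exists>x. \<forall>i X. graded_op i X \<longrightarrow> x \<le> i \<longrightarrow> X v = 0"
proof -
  \<comment> \<open>The summand \<open>2 * k + 3\<close> makes \<open>k + s - p / 2\<close> negative
    for \<open>p \<ge> Q\<close>, as \<open>s\<close> is at most 1/2.\<close>
  define Q where "Q = (k + 1) * k + 2 * k + 3"
  have kk: "(k + 1) * k \<ge> 0" using assms(5) by simp
  have L_high: "Lop p v = 0" if "p \<ge> Q" for p
    using L_vanish[OF assms(1,2,5)] that assms(5) by (simp add: Q_def)
  have M_high: "Mop (p + k) v = 0" if "p \<ge> Q" for p
  proof -
    have "smul (of_int k) (Mop (p + k) v) = 0"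
      using bracket_LM[of p k v] L_high[OF that] assms(3) op_zero[OF graded_op.L] op_zero[OF graded_op.M]
      by simp
    then show ?thesis using assms(5) by simp
  qed
  have Y_high: "Yop (p + k) v = 0" if "p \<ge> Q" for p
  proof -
    have "real_of_int p \<ge> 2 * real_of_int k + 3"
      using that kk unfolding Q_def by linarith
    then have "real_of_int k + s - real_of_int p / 2 < 0"
      using s_cases by auto
    then have "complex_of_real (real_of_int k + s - real_of_int p / 2) \<noteq> 0"
      by (metis less_irrefl of_real_eq_0_iff)
    moreover have "smul (complex_of_real (real_of_int k + s - real_of_int p / 2)) (Yop (p + k) v) = 0"
      using bracket_LY[of p k v] L_high[OF that] assms(4) op_zero[OF graded_op.L] op_zero[OF graded_op.Y]
      by simp
    ultimately show ?thesis using scale_eq_0_iff by blast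
  qed
  \<comment> \<open>The extra 1 absorbs \<open>\<sigma>\<close> when passing from doubled degrees to
    indices.\<close>
  have "X v = 0" if op: "graded_op i X" and i: "2 * (Q + k) + 1 \<le> i" for i X
    using op
  proof cases
    case (L n)
    then show ?thesis using i L_high[of n] assms(5) by simp
  next
    case (M n)
    then show ?thesis using i M_high[of "n - k"] by simp
  next
    case (Y n)
    then show ?thesis using i Y_high[of "n - k"] \<sigma>_cases by auto
  qed
  then show ?thesis by blast
qed

end

section \<open>Irreducible Harish-Chandra modules\<close>

locale sv_irr = sv_rep +
  assumes hc: "harish_chandra_module smul Lop"
    and irr: "sv_irreducible smul Lop Mop Yop"
begin

lemma generated_by_nonzero: "v \<noteq> 0 \<Longrightarrow> generated_by smul Lop Mop Yop v"
  using irr unfolding sv_irreducible_def generated_by_def by blast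

lemma submodule_UNIV:
  assumes "subspace W" "\<And>i X w. graded_op i X \<Longrightarrow> w \<in> W \<Longrightarrow> X w \<in> W" "v \<in> W" "v \<noteq> 0"
  shows "W = UNIV"
  using generated_by_nonzero[OF assms(4)] submoduleI[of W] assms(1-3)
  unfolding generated_by_def by blast

lemma wt_finite: obtains B where "finite B" "span B = wt \<mu>"
  using hc unfolding harish_chandra_module_def by blast

lemma eventually_vanish:
  assumes "v \<noteq> 0" "\<forall>i X. graded_op i X \<longrightarrow> x \<le> i \<longrightarrow> X v = 0"
  obtains y where "\<forall>i X. graded_op i X \<longrightarrow> y \<le> i \<longrightarrow> X u = 0"
proof -
  define W where "W = {u. \<exists>y. \<forall>i X. graded_op i X \<longrightarrow> y \<le> i \<longrightarrow> X u = 0}"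
  have "W = UNIV"
  proof (rule submodule_UNIV)
    show "subspace W"
    proof (rule subspaceI)
      show "0 \<in> W" using op_zero by (auto simp: W_def)
    next
      fix u w assume "u \<in> W" "w \<in> W"
      then obtain y z where y: "\<And>i X. graded_op i X \<Longrightarrow> y \<le> i \<Longrightarrow> X u = 0"
        and z: "\<And>i X. graded_op i X \<Longrightarrow> z \<le> i \<Longrightarrow> X w = 0" by (auto simp: W_def)
      have "X (u + w) = 0" if "graded_op i X" "max y z \<le> i" for i X
        using y[OF that(1)] z[OF that(1)] that by (simp add: op_add)
      then show "u + w \<in> W" unfolding W_def by blast
    next
      fix c u assume "u \<in> W"
      then show "smul c u \<in> W" unfolding W_def by (auto simp: op_scale)
    qed
  next
    fix i X w assume X: "graded_op i X" and "w \<in> W"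
    then obtain y where y: "\<And>j Z. graded_op j Z \<Longrightarrow> y \<le> j \<Longrightarrow> Z w = 0" by (auto simp: W_def)
    \<comment> \<open>The two bounds ensure \<open>j \<ge> y\<close> and
      \<open>j + i \<ge> y\<close>, so both terms of the commutation formula vanish on
      \<open>w\<close>.\<close>
    have "Z (X w) = 0" if Z: "graded_op j Z" "max y (y - i) \<le> j" for j Z
    proof -
      obtain c R where "graded_op (j + i) R" "Z (X w) = X (Z w) + smul c (R w)"
        using graded_bracket[OF Z(1) X] by blast
      then show ?thesis using y[OF Z(1)] y[of "j + i" R] Z(2) op_zero[OF X] by simp
    qed
    then show "X w \<in> W" unfolding W_def by blast
  qed (use assms in \<open>auto simp: W_def\<close>)
  then show ?thesis using that by (auto simp: W_def)
qed

lemma op_wt_shift: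
  "graded_op i X \<Longrightarrow> v \<in> wt (\<alpha> + of_int k / 2) \<Longrightarrow> X v \<in> wt (\<alpha> + of_int (k + i) / 2)"
  using op_wt[of i X v "\<alpha> + of_int k / 2"] by (simp add: add_divide_distrib add.assoc)

text \<open>The sum of the weight spaces in one coset is stable under all operators, so
  irreducibility leaves no room for weights outside it.\<close>

lemma weights_in_coset:
  assumes "wt \<alpha> \<noteq> {0}" "wt \<mu> \<noteq> {0}"
  obtains j :: int where "\<mu> = \<alpha> + of_int j / 2"
proof -
  define A where "A = range (\<lambda>j::int. \<alpha> + of_int j / 2)"
  obtain v where v: "v \<in> wt \<alpha>" "v \<noteq> 0" using assms(1) subspace_0[OF subspace_wt] by blast
  obtain u where u: "u \<in> wt \<mu>" "u \<noteq> 0" using assms(2) subspace_0[OF subspace_wt] by blast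
  have "span (\<Union>\<nu>\<in>A. wt \<nu>) = UNIV"
  proof (rule submodule_UNIV)
    fix i X w assume X: "graded_op i X" and w: "w \<in> span (\<Union>\<nu>\<in>A. wt \<nu>)"
    from w show "X w \<in> span (\<Union>\<nu>\<in>A. wt \<nu>)"
    proof (induction rule: span_induct_alt)
      case base
      then show ?case by (simp add: op_zero[OF X] span_zero)
    next
      case (step c x y)
      then obtain j :: int where "x \<in> wt (\<alpha> + of_int j / 2)" by (auto simp: A_def)
      then have "X x \<in> wt (\<alpha> + of_int (j + i) / 2)"
        by (rule op_wt_shift[OF X])
      then have "X x \<in> span (\<Union>\<nu>\<in>A. wt \<nu>)" 
        by (rule span_base[OF UN_I[rotated]]) (simp add: A_def del: of_int_add)
      then show ?case
        using step by (simp add: op_add[OF X] op_scale[OF X] span_add span_scale)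
    qed
  next
    have "\<alpha> \<in> A" unfolding A_def by (rule range_eqI[of _ _ 0]) simp
    then show "v \<in> span (\<Union>\<nu>\<in>A. wt \<nu>)" using v by (intro span_base) blast
  qed (use v in auto)
  then have "\<mu> \<in> A" using wt_disjoint_span[of u A \<mu>] u by blast
  then show ?thesis using that by (auto simp: A_def)
qed

section \<open>The submodule generated from below a window\<close>

text \<open>
  The family \<open>span {v. tower \<alpha> k v}\<close> is stable under all operators, although above degree \<open>4\<close> it is
  built with raising operators only.
\<close>

inductive tower :: "complex \<Rightarrow> int \<Rightarrow> 'a \<Rightarrow> bool" for \<alpha> where
  base: "k < 4 \<Longrightarrow> v \<in> wt (\<alpha> + of_int k / 2) \<Longrightarrow> tower \<alpha> k v"
| step: "tower \<alpha> k v \<Longrightarrow> graded_op i X \<Longrightarrow> 0 < i \<Longrightarrow> i \<le> 4 \<Longrightarrow> tower \<alpha> (k + i) (X v)"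

abbreviation tower_span :: "complex \<Rightarrow> int \<Rightarrow> 'a set" where
  "tower_span \<alpha> k \<equiv> span {v. tower \<alpha> k v}"

lemma tower_wt: "tower \<alpha> k v \<Longrightarrow> v \<in> wt (\<alpha> + of_int k / 2)"
  by (induction rule: tower.induct) (use op_wt_shift in blast)+

lemma tower_span_wt: "v \<in> tower_span \<alpha> k \<Longrightarrow> v \<in> wt (\<alpha> + of_int k / 2)"
  using span_minimal[OF _ subspace_wt, of "{v. tower \<alpha> k v}"] tower_wt by blast

lemma tower_span_op:
  assumes X: "graded_op i X" and base: "\<And>v. tower \<alpha> k v \<Longrightarrow> X v \<in> tower_span \<alpha> (k + i)"
    and v: "v \<in> tower_span \<alpha> k"
  shows "X v \<in> tower_span \<alpha> (k + i)"
  using v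
proof (induction rule: span_induct_alt)
  case base
  then show ?case by (simp add: op_zero[OF X] span_zero)
next
  case (step c x y)
  then show ?case
    using base by (simp add: op_add[OF X] op_scale[OF X] span_add span_scale)
qed

lemma tower_span_raise:
  assumes X: "graded_op i X" "0 < i" "i \<le> 4" and v: "v \<in> tower_span \<alpha> k"
  shows "X v \<in> tower_span \<alpha> (k + i)"
  using tower_span_op[OF X(1) _ v] tower.step X span_base by blast

text \<open>An operator of degree at most 0 is commuted past the last raising operator; the bracket
  still has degree at most 4 in absolute value, so the induction hypothesis covers it.\<close>

lemma tower_small:
  assumes "tower \<alpha> k v" "graded_op j Z" "\<bar>j\<bar> \<le> 4"
  shows "Z v \<in> tower_span \<alpha> (k + j)"
  using assms
proof (induction arbitrary: j Z rule: tower.induct)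
  case (base k v)
  show ?case
  proof (cases "k + j < 4")
    case True
    have "tower \<alpha> (k + j) (Z v)"
      using True op_wt_shift[OF base.prems(1) base.hyps(2)] by (rule tower.base)
    then show ?thesis by (simp add: span_base)
  next
    case False
    \<comment> \<open>Since \<open>k < 4\<close>, here \<open>j\<close> is positive and
      \<open>Z\<close> is itself a raising step.\<close>
    have "tower \<alpha> (k + j) (Z v)"
      using False base tower.base tower.step[of \<alpha> k v j Z] by auto
    then show ?thesis by (simp add: span_base)
  qed
next
  case (step k v i X)
  show ?case
  proof (cases "0 < j")
    case True
    have "tower \<alpha> (k + i + j) (Z (X v))"
      using tower.step[OF tower.step[OF step.hyps]] step.prems True by auto
    then show ?thesis by (simp add: span_base)
  next
    case False
    obtain c R where R: "graded_op (j + i) R" "Z (X v) = X (Z v) + smul c (R v)"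
      using graded_bracket[OF step.prems(1) step.hyps(2)] by blast
    have "R v \<in> tower_span \<alpha> (k + i + j)"
      using step.IH[OF R(1)] False step.hyps step.prems by (simp add: ac_simps)
    moreover have "X (Z v) \<in> tower_span \<alpha> (k + i + j)"
      using tower_span_raise[OF step.hyps(2-4) step.IH[OF step.prems]] by (simp add: ac_simps)
    ultimately show ?thesis by (simp add: R(2) span_add span_scale)
  qed
qed

text \<open>Stability under degrees up to 4 passes to all degrees, because it is inherited by
  brackets with nonzero structure constant.\<close>

lemma tower_span_stable:
  assumes "graded_op j Z" "v \<in> tower_span \<alpha> k"
  shows "Z v \<in> tower_span \<alpha> (k + j)"
proof -
  define P where "P j Z \<longleftrightarrow> (\<forall>k. \<forall>v \<in> tower_span \<alpha> k. Z v \<in> tower_span \<alpha> (k + j))" for j Z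
  have "P j Z"
    using assms(1)
  proof (rule bracket_invariant_all[rotated 2])
    fix i X assume "graded_op i X" "\<bar>i\<bar> \<le> 4"
    then show "P i X" unfolding P_def using tower_span_op tower_small by blast
  next
    fix i j X Z R c
    assume P: "P i X" "P j Z" and R: "\<And>v. X (Z v) - Z (X v) = smul c (R v)" "c \<noteq> 0"
    show "P (i + j) R"
      unfolding P_def
    proof (intro allI ballI)
      fix k v assume v: "v \<in> tower_span \<alpha> k"
      have "X (Z v) \<in> tower_span \<alpha> (k + j + i)" "Z (X v) \<in> tower_span \<alpha> (k + i + j)"
        using P v unfolding P_def by blast+
      then have "smul c (R v) \<in> tower_span \<alpha> (k + (i + j))"
        by (simp add: R(1)[symmetric] span_diff ac_simps)
      then have "smul (inverse c) (smul c (R v)) \<in> tower_span \<alpha> (k + (i + j))"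
        by (rule span_scale)
      then show "R v \<in> tower_span \<alpha> (k + (i + j))" using R(2) by simp
    qed
  qed
  then show ?thesis using assms(2) unfolding P_def by blast
qed

text \<open>Commuting \<open>Z\<close> past a raising operator only produces operators of larger
  degree, so the bound \<open>x\<close> from the window survives every raising step.\<close>

lemma tower_vanish:
  assumes "tower \<alpha> k v" "0 \<le> k"
    and x: "\<And>k u j Z. 0 \<le> k \<Longrightarrow> k < 4 \<Longrightarrow> u \<in> wt (\<alpha> + of_int k / 2) \<Longrightarrow> graded_op j Z \<Longrightarrow>
      x \<le> j \<Longrightarrow> Z u = 0"
    and "graded_op j Z" "x \<le> j"
  shows "Z v = 0"
  using assms(1,2,4,5)
proof (induction arbitrary: j Z rule: tower.induct)
  case (base k v)
  then show ?case using x by blast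
next
  case (step k v i X)
  show ?case
  proof (cases "0 \<le> k")
    case True
    obtain c R where R: "graded_op (j + i) R" "Z (X v) = X (Z v) + smul c (R v)"
      using graded_bracket[OF step.prems(2) step.hyps(2)] by blast
    then show ?thesis
      using step.IH[OF True step.prems(2,3)] step.IH[OF True R(1)] step.prems(3) step.hyps
      by (simp add: op_zero)
  next
    case False
    \<comment> \<open>A step of degree at most 4 from below 0 cannot jump over the window, so the
      hypothesis \<open>x\<close> applies directly.\<close>
    have "X v \<in> wt (\<alpha> + of_int (k + i) / 2)"
      using op_wt_shift[OF step.hyps(2) tower_wt[OF step.hyps(1)]] .
    then show ?thesis using x[of "k + i"] False step.prems step.hyps(4) by auto
  qed
qed

section \<open>Highest weight vectors from vanishing and from unbounded multiplicities\<close>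

lemma highest_weightI:
  assumes "v \<noteq> 0" "v \<in> wt \<mu>" "\<And>i X. graded_op i X \<Longrightarrow> 0 < i \<Longrightarrow> X v = 0"
  shows "highest_weight_module s smul Lop Mop Yop"
  unfolding highest_weight_module_def
proof (intro exI conjI allI impI)
  show "Lop n v = 0" "Mop n v = 0" if "n > 0" for n
    using assms(3)[OF graded_op.L] assms(3)[OF graded_op.M] that by auto
  show "Yop k v = 0" if "real_of_int k + s > 0" for k
  proof (rule assms(3)[OF graded_op.Y])
    have "real_of_int (2 * k + \<sigma>) > 0"
      using that s_eq by simp
    then show "0 < 2 * k + \<sigma>" by linarith
  qed
qed (use assms generated_by_nonzero in auto)

text \<open>The bounds for individual vectors have a maximum over a finite spanning set, and it
  serves the whole weight space.\<close>

lemma wt_vanish: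
  assumes "v \<noteq> 0" "\<forall>i X. graded_op i X \<longrightarrow> y \<le> i \<longrightarrow> X v = 0"
  shows "\<exists>x. \<forall>u i X. u \<in> wt \<mu> \<longrightarrow> graded_op i X \<longrightarrow> x \<le> i \<longrightarrow> X u = 0"
proof -
  obtain B where B: "finite B" "span B = wt \<mu>" by (rule wt_finite)
  have "\<forall>u. \<exists>z. \<forall>i X. graded_op i X \<longrightarrow> z \<le> i \<longrightarrow> X u = 0"
    using eventually_vanish[OF assms] by blast
  then obtain y where y: "\<forall>i X. graded_op i X \<longrightarrow> y u \<le> i \<longrightarrow> X u = 0" for u
    by (auto dest!: choice)
  define x where "x = Max (insert 0 (y ` B))"
  have "X u = 0" if "u \<in> wt \<mu>" and X: "graded_op i X" "x \<le> i" for u i X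
  proof -
    have "u \<in> span B" using that(1) B(2) by simp
    then show ?thesis
    proof (induction rule: span_induct_alt)
      case (step c b u)
      then have "y b \<le> x" using B(1) by (simp add: x_def)
      then show ?case using step y X by (simp add: op_add op_scale)
    qed (use X op_zero in blast)
  qed
  then show ?thesis by blast
qed

lemma highest_weight_of_vanish:
  assumes "v \<noteq> 0" "\<forall>i X. graded_op i X \<longrightarrow> y \<le> i \<longrightarrow> X v = 0" and \<alpha>: "wt \<alpha> \<noteq> {0}"
  shows "highest_weight_module s smul Lop Mop Yop"
proof -
  have "\<exists>f. \<forall>\<mu>. \<forall>u i X. u \<in> wt \<mu> \<longrightarrow> graded_op i X \<longrightarrow> f \<mu> \<le> i \<longrightarrow> X u = 0"
    by (rule choice, rule allI, rule wt_vanish[OF assms(1,2)])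
  then obtain f where f: "\<And>\<mu> u i X. u \<in> wt \<mu> \<Longrightarrow> graded_op i X \<Longrightarrow> f \<mu> \<le> i \<Longrightarrow> X u = 0"
    by blast
  define x where "x = Max ((\<lambda>k. f (\<alpha> + of_int k / 2)) ` {0..<4::int})"
  have vanish: "Z u = 0" if "0 \<le> k" "u \<in> tower_span \<alpha> k" and Z: "graded_op j Z" "x \<le> j" for k u j Z
    using that(2)
  proof (induction rule: span_induct_alt)
    case base
    then show ?case using Z op_zero by blast
  next
    case (step c b u)
    have "Z b = 0"
    proof (rule tower_vanish[of \<alpha> k b x j Z])
      fix k u j Z assume *: "0 \<le> k" "k < 4" "u \<in> wt (\<alpha> + of_int k / 2)" "graded_op j Z" "x \<le> j"
      have "f (\<alpha> + of_int k / 2) \<le> x" using *(1,2) by (simp add: x_def)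
      then show "Z u = 0" using f * by (meson order_trans)
    qed (use step Z that(1) in auto)
    then show ?case using step Z by (simp add: op_add op_scale)
  qed
  \<comment> \<open>\<open>J \<ge> x\<close> puts the operators of index \<open>n + J\<close> used
    below beyond the bound \<open>x\<close>, and \<open>J \<ge> 1\<close> helps keep their structure
    constants with \<open>Lop (- J)\<close> positive.\<close>
  define J where "J = max x 1"
  show ?thesis
  proof (cases "\<exists>k \<ge> 2 * J. \<exists>u \<in> tower_span \<alpha> k. u \<noteq> 0")
    case True
    then obtain k u where k: "k \<ge> 2 * J" and u: "u \<in> tower_span \<alpha> k" "u \<noteq> 0" by blast
    have J: "J \<ge> 1" "J \<ge> x" by (auto simp: J_def)
    have low: "Lop (- J) u \<in> tower_span \<alpha> (k - 2 * J)"
      using tower_span_stable[OF graded_op.L u(1), of "- J"] by simp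
    have kill: "Z (Lop (- J) u) = 0" "Z u = 0" if "graded_op j Z" "j \<ge> x" for j Z
      using vanish[OF _ low that] vanish[OF _ u(1) that] k J by auto
    show ?thesis
    proof (rule highest_weightI[OF u(2) tower_span_wt[OF u(1)]])
      fix i X assume "graded_op i X" and i: "0 < i"
      then show "X u = 0"
      proof cases
        case (L n)
        \<comment> \<open>\<open>Lop (n + J)\<close> kills both \<open>u\<close> and
          \<open>Lop (- J) u\<close>, so its bracket with \<open>Lop (- J)\<close> kills
          \<open>u\<close>. The cases of \<open>Mop\<close> and \<open>Yop\<close> work the same
          way.\<close>
        have "smul (of_int (n + J + J)) (Lop n u) = 0"
          using bracket_LL[of "- J" "n + J" u] kill[OF graded_op.L[of "n + J"]] i L J
            op_zero[OF graded_op.L] by simp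
        moreover have "n + J + J \<noteq> 0" using i L J by linarith
        ultimately show ?thesis using L by (metis of_int_eq_0_iff scale_eq_0_iff)
      next
        case (M n)
        have "smul (of_int (n + J)) (Mop n u) = 0"
          using bracket_LM[of "- J" "n + J" u] kill[OF graded_op.M[of "n + J"]] i M J
            op_zero[OF graded_op.L] by simp
        moreover have "n + J \<noteq> 0" using i M J by linarith
        ultimately show ?thesis using M by (metis of_int_eq_0_iff scale_eq_0_iff)
      next
        case (Y n)
        have "smul (complex_of_real (real_of_int (n + J) + s - real_of_int (- J) / 2)) (Yop n u) = 0"
          using bracket_LY[of "- J" "n + J" u] kill[OF graded_op.Y[of "n + J"]] i Y J \<sigma>_cases
            op_zero[OF graded_op.L] by auto
        moreover have "real_of_int (n + J) + s - real_of_int (- J) / 2 > 0"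
        proof -
          have "real_of_int (2 * n + \<sigma>) > 0" "real_of_int J \<ge> 1" using i Y J by auto
          then show ?thesis using s_eq by simp
        qed
        ultimately show ?thesis using Y by (metis less_irrefl of_real_eq_0_iff scale_eq_0_iff)
      qed
    qed
  next
    case False
    obtain w where w: "w \<in> wt \<alpha>" "w \<noteq> 0" using \<alpha> subspace_0[OF subspace_wt] by blast
    \<comment> \<open>No nonzero vector of a tower span has degree \<open>2 * J\<close> or more, and
      \<open>w\<close> occupies degree 0; so a top degree exists, and raising out of it gives
      0.\<close>
    define K where "K = {k. 0 \<le> k \<and> (\<exists>u \<in> tower_span \<alpha> k. u \<noteq> 0)}"
    have "w \<in> tower_span \<alpha> 0" using w by (intro span_base) (auto intro: tower.base)
    then have "0 \<in> K" using w(2) by (auto simp: K_def)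
    moreover have "finite K"
    proof (rule finite_subset[of _ "{0..2 * J}"])
      show "K \<subseteq> {0..2 * J}"
      proof
        fix k assume "k \<in> K"
        then show "k \<in> {0..2 * J}" using False by (cases "2 * J \<le> k") (auto simp: K_def)
      qed
    qed simp
    ultimately have "Max K \<in> K" and K: "\<And>k. k \<in> K \<Longrightarrow> k \<le> Max K"
      using Max_in Max_ge by blast+
    then obtain u where u: "u \<in> tower_span \<alpha> (Max K)" "u \<noteq> 0" "0 \<le> Max K" by (auto simp: K_def)
    show ?thesis
    proof (rule highest_weightI[OF u(2) tower_span_wt[OF u(1)]])
      fix i X assume X: "graded_op i X" and i: "0 < i"
      have "Max K + i \<in> K" if "X u \<noteq> 0"
        unfolding K_def[THEN eqset_imp_iff] mem_Collect_eq
        using tower_span_stable[OF X u(1)] u(3) i that by (intro conjI bexI[of _ "X u"]) auto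
      then show "X u = 0" using K[of "Max K + i"] i by linarith
    qed
  qed
qed

text \<open>\<open>X\<close> sends \<open>U\<close> into one of the four weight spaces of the
  window, so passing to its kernel costs at most their total dimension.\<close>

lemma dim_kernel_op:
  assumes X: "graded_op i X" and U: "subspace U" "U \<subseteq> wt (\<alpha> + of_int j / 2)"
    and ij: "j + i \<in> {0..<4}"
  shows "dim U \<le> dim {u \<in> U. X u = 0} + (\<Sum>k\<in>{0..<4::int}. dim (wt (\<alpha> + of_int k / 2)))"
    and "subspace {u \<in> U. X u = 0}"
proof -
  obtain B where B: "finite B" "span B = wt (\<alpha> + of_int j / 2)" by (rule wt_finite)
  have "dim U \<le> dim {u \<in> U. X u = 0} + dim (X ` U)"
    using dim_kernel_image[OF linear_op[OF X] U(1) B(1)] B(2) U(2) by simp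
  moreover obtain C where C: "finite C" "span C = wt (\<alpha> + of_int (j + i) / 2)" by (rule wt_finite)
  have "X ` U \<subseteq> wt (\<alpha> + of_int (j + i) / 2)" 
    using op_wt_shift[OF X, of _ \<alpha> j] U(2) by (auto simp del: of_int_add)
  then have "dim (X ` U) \<le> dim (wt (\<alpha> + of_int (j + i) / 2))"
    by (intro dim_mono_finite[OF _ C(1)]) (simp_all add: C(2) span_eq_iff[THEN iffD2, OF subspace_wt])
  moreover have "\<dots> \<le> (\<Sum>k\<in>{0..<4::int}. dim (wt (\<alpha> + of_int k / 2)))"
    using member_le_sum[of "j + i" "{0..<4::int}" "\<lambda>k. dim (wt (\<alpha> + of_int k / 2))"] ij by simp
  ultimately show "dim U \<le> dim {u \<in> U. X u = 0} + (\<Sum>k\<in>{0..<4::int}. dim (wt (\<alpha> + of_int k / 2)))"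
    by linarith
  show "subspace {u \<in> U. X u = 0}"
    using U(1) by (auto simp: subspace_def op_zero[OF X] op_add[OF X] op_scale[OF X])
qed

lemma highest_weight_of_unbounded:
  assumes \<alpha>: "wt \<alpha> \<noteq> {0}" and unb: "\<And>N. \<exists>j\<le>0. N < dim (wt (\<alpha> + of_int j / 2))"
  shows "highest_weight_module s smul Lop Mop Yop"
proof -
  define D where "D = (\<Sum>k\<in>{0..<4::int}. dim (wt (\<alpha> + of_int k / 2)))"
  \<comment> \<open>Exceeding the fixed dimension in degree 0 as well excludes \<open>j = 0\<close>,
    which would give \<open>k = 0\<close> below.\<close>
  have *: "\<exists>j\<le>-1. N < dim (wt (\<alpha> + of_int j / 2))" for N
  proof -
    obtain j where j: "j \<le> 0" "N + dim (wt (\<alpha> + of_int 0 / 2)) < dim (wt (\<alpha> + of_int j / 2))"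
      using unb by blast
    then have "j \<noteq> 0" by (intro notI) simp
    then show ?thesis using j by (intro exI[of _ j]) auto
  qed
  \<comment> \<open>Four kernels are taken in turn, each costing at most \<open>D\<close>, so
    \<open>?U4\<close> stays nonzero.\<close>
  obtain j where j: "j \<le> -1" "4 * D < dim (wt (\<alpha> + of_int j / 2))" using * by blast
  \<comment> \<open>With this \<open>k\<close>, \<open>Lop k\<close> and \<open>Mop k\<close> land
    in degree 0 or 1, \<open>Lop (k + 1)\<close> in 2 or 3 and \<open>Yop k\<close> between 0 and 2;
    hence a window of four.\<close>
  define k where "k = (1 - j) div 2"
  have k: "k \<ge> 1" "j + 2 * k \<in> {0, 1}" using j(1) by (auto simp: k_def)
  let ?U0 = "wt (\<alpha> + of_int j / 2)"
  let ?U1 = "{u \<in> ?U0. Lop k u = 0}"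
  let ?U2 = "{u \<in> ?U1. Lop (k + 1) u = 0}"
  let ?U3 = "{u \<in> ?U2. Mop k u = 0}"
  let ?U4 = "{u \<in> ?U3. Yop k u = 0}"
  have range: "j + 2 * k \<in> {0..<4}" "j + 2 * (k + 1) \<in> {0..<4}" "j + (2 * k + \<sigma>) \<in> {0..<4}"
    using k(2) \<sigma>_cases by auto
  have sub: "?U0 \<subseteq> ?U0" "?U1 \<subseteq> ?U0" "?U2 \<subseteq> ?U0" "?U3 \<subseteq> ?U0" by blast+
  note 1 = dim_kernel_op[OF graded_op.L subspace_wt sub(1) range(1), folded D_def]
  note 2 = dim_kernel_op[OF graded_op.L 1(2) sub(2) range(2), folded D_def]
  note 3 = dim_kernel_op[OF graded_op.M 2(2) sub(3) range(1), folded D_def]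
  note 4 = dim_kernel_op(1)[OF graded_op.Y 3(2) sub(4) range(3), folded D_def]
  have "dim ?U4 > 0" using 1(1) 2(1) 3(1) 4 j(2) by linarith
  then have "\<not> ?U4 \<subseteq> span {}" using dim_le_card[of ?U4 "{}"] by auto
  then obtain v where v: "v \<in> ?U4" "v \<noteq> 0" by auto
  then obtain y where "\<forall>i X. graded_op i X \<longrightarrow> y \<le> i \<longrightarrow> X v = 0"
    using high_degree_vanish[of k v] k(1) by auto
  then show ?thesis by (rule highest_weight_of_vanish[OF v(2) _ \<alpha>])
qed

end

section \<open>The automorphism reversing degrees\<close>

lemma sv_module_reverse:
  assumes "s \<in> {0, 1/2}" "sv_module s smul Lop Mop Yop"
  shows "sv_module s smul (\<lambda>n v. - Lop (- n) v) (\<lambda>n v. - Mop (- n) v)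
    (\<lambda>k v. Yop (- k - \<lfloor>2 * s\<rfloor>) v)"
proof -
  interpret vector_space smul using assms(2) by (simp add: sv_module_def)
  interpret sv_rep smul s Lop Mop Yop using assms by unfold_locales
  have neg: "X (- v) = - X v" if "graded_op i X" for i X v
    using op_scale[OF that, of "-1" v] by simp
  have neg_lin: "Vector_Spaces.linear smul smul (\<lambda>v. - X v)" if "graded_op i X" for i X
    by unfold_locales (simp_all add: op_add[OF that] op_scale[OF that])
  show ?thesis
    unfolding sv_module_def
  proof (intro conjI allI)
    show "vector_space smul" by unfold_locales
    show "Vector_Spaces.linear smul smul (\<lambda>v. - Lop (- n) v)"
      "Vector_Spaces.linear smul smul (\<lambda>v. - Mop (- n) v)"
      "Vector_Spaces.linear smul smul (\<lambda>v. Yop (- n - \<sigma>) v)" for n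
      using neg_lin[OF graded_op.L] neg_lin[OF graded_op.M] linear_op[OF graded_op.Y] by auto
    fix m n v
    note simps = neg[OF graded_op.L] neg[OF graded_op.M] neg[OF graded_op.Y]
    show "- Lop (- m) (- Lop (- n) v) - - Lop (- n) (- Lop (- m) v)
        = smul (of_int (n - m)) (- Lop (- (m + n)) v)"
    proof -
      have "- n - - m = - (n - m)" "- m + - n = - (m + n)" by auto
      then show ?thesis
        using bracket_LL[of "- m" "- n" v]
        by (simp only: simps of_int_minus scale_minus_left scale_minus_right minus_minus)
    qed
    show "- Lop (- m) (- Mop (- n) v) - - Mop (- n) (- Lop (- m) v)
        = smul (of_int n) (- Mop (- (m + n)) v)"
      using bracket_LM[of "- m" "- n" v]
      by (simp only: simps of_int_minus scale_minus_left scale_minus_right minus_minus minus_add_distrib)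
    show "- Lop (- m) (Yop (- n - \<sigma>) v) - Yop (- n - \<sigma>) (- Lop (- m) v)
        = smul (complex_of_real (real_of_int n + s - real_of_int m / 2)) (Yop (- (m + n) - \<sigma>) v)"
    proof -
      \<comment> \<open>\<open>Yop (- n - \<sigma>)\<close> is the action of \<open>Y\<close> at
        \<open>- (n + s)\<close>, because \<open>\<sigma>\<close> equals
        \<open>2 * s\<close>.\<close>
      have "real_of_int (- n - \<sigma>) + s - real_of_int (- m) / 2
          = - (real_of_int n + s - real_of_int m / 2)"
        using s_eq by simp
      moreover have "- (m + n) - \<sigma> = - m + (- n - \<sigma>)" by simp
      ultimately show ?thesis
        using bracket_LY[of "- m" "- n - \<sigma>" v]
        by (simp only: simps of_real_minus scale_minus_left) (simp add: algebra_simps)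
    qed
    show "Yop (- m - \<sigma>) (Yop (- n - \<sigma>) v) - Yop (- n - \<sigma>) (Yop (- m - \<sigma>) v)
        = smul (of_int (n - m)) (- Mop (- (m + n + \<sigma>)) v)"
    proof -
      have "- n - \<sigma> - (- m - \<sigma>) = - (n - m)" "- m - \<sigma> + (- n - \<sigma>) + \<sigma> = - (m + n + \<sigma>)" by auto
      then show ?thesis
        using bracket_YY[of "- m - \<sigma>" "- n - \<sigma>" v]
        by (simp only: of_int_minus scale_minus_left scale_minus_right)
    qed
    show "- Mop (- m) (- Mop (- n) v) = - Mop (- n) (- Mop (- m) v)"
      by (simp add: simps bracket_MM)
    show "- Mop (- m) (Yop (- n - \<sigma>) v) = Yop (- n - \<sigma>) (- Mop (- m) v)"
      by (simp add: simps bracket_MY)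
  qed
qed

text \<open>Subspaces are closed under negation, and reflecting the index permutes each family of
  operators. Irreducibility thus carries over to the reversed action.\<close>

lemma (in sv_rep) sv_submodule_reverse_iff:
  "sv_submodule smul (\<lambda>n v. - Lop (- n) v) (\<lambda>n v. - Mop (- n) v) (\<lambda>k v. Yop (- k - \<sigma>) v) W
    \<longleftrightarrow> sv_submodule smul Lop Mop Yop W"
proof -
  have minus: "- v \<in> W \<longleftrightarrow> v \<in> W" if "subspace W" for v
    using subspace_neg[OF that, of v] subspace_neg[OF that, of "- v"] by auto
  have reflect: "(\<forall>n. P (c - n)) \<longleftrightarrow> (\<forall>n. P n)" for P and c :: int
  proof
    assume *: "\<forall>n. P (c - n)"
    show "\<forall>n. P n"
    proof
      fix n show "P n" using *[rule_format, of "c - n"] by simp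
    qed
  qed blast
  have "(\<forall>n. Lop (- n) w \<in> W) \<longleftrightarrow> (\<forall>n. Lop n w \<in> W)" "(\<forall>n. Mop (- n) w \<in> W) \<longleftrightarrow> (\<forall>n. Mop n w \<in> W)"
    "(\<forall>n. Yop (- n - \<sigma>) w \<in> W) \<longleftrightarrow> (\<forall>n. Yop n w \<in> W)" for w
    using reflect[of "\<lambda>n. Lop n w \<in> W" 0] reflect[of "\<lambda>n. Mop n w \<in> W" 0]
      reflect[of "\<lambda>n. Yop n w \<in> W" "- \<sigma>"] by (simp_all add: minus_diff_commute)
  then have "(\<forall>n. \<forall>w\<in>W. Lop (- n) w \<in> W \<and> Mop (- n) w \<in> W \<and> Yop (- n - \<sigma>) w \<in> W) \<longleftrightarrow>
      (\<forall>n. \<forall>w\<in>W. Lop n w \<in> W \<and> Mop n w \<in> W \<and> Yop n w \<in> W)" by blast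
  then show ?thesis
    unfolding sv_submodule_def by (cases "subspace W") (simp_all only: minus simp_thms)
qed

section \<open>Unbounded multiplicities in either direction\<close>

theorem theorem1p2:
  fixes s :: real
    and smul :: "complex \<Rightarrow> 'v::ab_group_add \<Rightarrow> 'v"
    and Lop Mop Yop :: "int \<Rightarrow> 'v \<Rightarrow> 'v"
  assumes "s \<in> {0, 1/2}"
    and "sv_module s smul Lop Mop Yop"
    and "harish_chandra_module smul Lop"
    and "sv_irreducible smul Lop Mop Yop"
  shows "highest_weight_module s smul Lop Mop Yop \<or> lowest_weight_module s smul Lop Mop Yop
         \<or> uniformly_bounded smul Lop"
proof (cases "uniformly_bounded smul Lop")
  case False
  interpret vector_space smul using assms(2) by (simp add: sv_module_def)
  interpret sv_irr smul s Lop Mop Yop using assms by unfold_locales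
  let ?L = "\<lambda>n v. - Lop (- n) v" and ?M = "\<lambda>n v. - Mop (- n) v" and ?Y = "\<lambda>k v. Yop (- k - \<sigma>) v"
  have wt_reverse: "weight_space smul ?L \<mu> = wt (- \<mu>)" for \<mu>
    by (simp add: weight_space_def minus_equation_iff[of "Lop 0 _"]) (simp add: eq_commute)
  have wts: "(\<Union>\<mu>. wt (- \<mu>)) = (\<Union>\<mu>. wt \<mu>)"
  proof (intro equalityI subsetI)
    fix v assume "v \<in> (\<Union>\<mu>. wt \<mu>)"
    then obtain \<mu> where "v \<in> wt (- (- \<mu>))" by auto
    then show "v \<in> (\<Union>\<mu>. wt (- \<mu>))" by blast
  qed blast
  interpret rev: sv_irr smul s ?L ?M ?Y
  proof unfold_locales
    show "sv_module s smul ?L ?M ?Y" using assms(1,2) by (rule sv_module_reverse)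
    show "harish_chandra_module smul ?L"
      using assms(3) unfolding harish_chandra_module_def weight_module_def wt_reverse wts by blast
    show "sv_irreducible smul ?L ?M ?Y"
      using assms(4) unfolding sv_irreducible_def sv_submodule_reverse_iff .
  qed (rule assms(1))
  have unb: "\<exists>\<mu>. N < dim (wt \<mu>)" for N :: nat
    using False unfolding uniformly_bounded_def by (meson not_le)
  have nonzero: "wt \<mu> \<noteq> {0}" if "N < dim (wt \<mu>)" for N \<mu>
    using that dim_le_card[of "{0}" "{}"] by auto
  obtain \<alpha> where \<alpha>: "wt \<alpha> \<noteq> {0}" using unb[of 0] nonzero by blast
  \<comment> \<open>A weight space of positive dimension is nonzero, so its weight lies in the coset
    of \<alpha>.\<close>
  have unb': "\<exists>j. N < dim (wt (\<alpha> + of_int j / 2))" for N :: nat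
    using unb[of N] nonzero weights_in_coset[OF \<alpha>] by metis
  show ?thesis
  proof (cases "\<forall>N. \<exists>j\<le>0. N < dim (wt (\<alpha> + of_int j / 2))")
    case True
    then show ?thesis using highest_weight_of_unbounded[OF \<alpha>] by blast
  next
    case False
    then obtain N0 where N0: "\<And>j. j \<le> 0 \<Longrightarrow> dim (wt (\<alpha> + of_int j / 2)) \<le> N0" by (meson not_le)
    have "\<exists>j\<le>0. N < dim (weight_space smul ?L (- \<alpha> + of_int j / 2))" for N
    proof -
      \<comment> \<open>A dimension beyond \<open>N0\<close> forces \<open>j\<close> to be positive;
        reversal negates weights and so turns \<open>j\<close> into \<open>- j\<close>.\<close>
      obtain j where j: "max N N0 < dim (wt (\<alpha> + of_int j / 2))" using unb' by blast
      then have "0 \<le> j" using N0[of j] by linarith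
      moreover have eq: "- (- \<alpha> + of_int (- j) / 2) = \<alpha> + of_int j / 2" by simp
      have "N < dim (weight_space smul ?L (- \<alpha> + of_int (- j) / 2))"
        using j unfolding wt_reverse eq by simp
      ultimately show ?thesis by (intro exI[of _ "- j"]) simp
    qed
    then have "highest_weight_module s smul ?L ?M ?Y"
      using rev.highest_weight_of_unbounded[of "- \<alpha>"] \<alpha> unfolding wt_reverse by simp
    then obtain v \<mu> where v: "v \<noteq> 0" "v \<in> wt (- \<mu>)" and pos: "\<And>n. n > 0 \<Longrightarrow> - Lop (- n) v = 0 \<and> - Mop (- n) v = 0"
      "\<And>k. real_of_int k + s > 0 \<Longrightarrow> Yop (- k - \<sigma>) v = 0"
      unfolding highest_weight_module_def wt_reverse by blast
    have "Lop n v = 0 \<and> Mop n v = 0" if "n < 0" for n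
      using pos(1)[of "- n"] that by simp
    moreover have "Yop k v = 0" if "real_of_int k + s < 0" for k
    proof -
      have "real_of_int (- k - \<sigma>) + s > 0" using that s_eq by simp
      then show ?thesis using pos(2)[of "- k - \<sigma>"] by simp
    qed
    ultimately have "lowest_weight_module s smul Lop Mop Yop"
      unfolding lowest_weight_module_def using v generated_by_nonzero by blast
    then show ?thesis by blast
  qed
qed simp

end
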